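(* Let $\alpha$ be an irrational real number with Diophantine type $\beta=\beta(\alpha)$, and let $\varphi:\mathbb N\to\mathbb R^+$ be a function decreasing to zero. If $\beta\le 1/u_\varphi$, then $$\dim_H\big(E_\varphi(\alpha)\big)=u_\varphi .$$
   Context: $\|x\|$ denotes the distance from $x\in\mathbb R$ to the nearest integer, $\mathbb N$ is the set of positive integers, $\mathbb R^+$ the set of positive reals, and $\dim_H$ is Hausdorff dimension. "Decreasing" is understood in the weak sense (non-increasing). The Diophantine type of an irrational $\alpha$ is $\beta(\alpha):=\sup\{\theta\ge 1:\liminf_{n\to\infty} n^\theta\|n\alpha\|=0\}\in[1,\infty]$ (equal to $1$ if the set is empty). For $\varphi:\mathbb N\to\mathbb R^+$ decreasing to zero, $$E_\varphi(\alpha):=\{y\in\mathbb R:\ \|n\alpha-y\|<\varphi(n)\text{ for infinitely many } n\in\mathbb N\},\qquad u_\varphi:=\limsup_{n\to\infty}\frac{\log n}{-\log\varphi(n)},$$ with the convention $1/u_\varphi=\infty$ if $u_\varphi=0$ (and $1/u_\varphi=0$ if $u_\varphi=\infty$). *)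

theory Defs
  imports "HOL-Analysis.Analysis"
begin

definition dist_int :: "real \<Rightarrow> real" where
  "dist_int x = \<bar>x - of_int (round x)\<bar>"

text \<open>
  The usual Hausdorff outer measure and dimension, with countable covers given as sequences
  (empty sets allowed). Boundedness is required because \<^const>\<open>diameter\<close> is real-valued and
  meaningless on unbounded sets. Since \<open>0 powr 0 = 0\<close>, \<open>hausdorff_measure 0\<close> is not the counting
  measure; the exponent is therefore restricted to \<open>s > 0\<close> in the dimension, which
  does not affect the infimum.
\<close>

definition hausdorff_pre_measure :: "real \<Rightarrow> real \<Rightarrow> 'a::metric_space set \<Rightarrow> ennreal" where
  "hausdorff_pre_measure s \<delta> A =
     Inf {(\<Sum>i. ennreal (diameter (U i) powr s)) | U :: nat \<Rightarrow> 'a set.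
            A \<subseteq> (\<Union>i. U i) \<and> (\<forall>i. bounded (U i) \<and> diameter (U i) \<le> \<delta>)}"

definition hausdorff_measure :: "real \<Rightarrow> 'a::metric_space set \<Rightarrow> ennreal" where
  "hausdorff_measure s A = (SUP \<delta>\<in>{0<..}. hausdorff_pre_measure s \<delta> A)"

definition hausdorff_dim :: "'a::metric_space set \<Rightarrow> ereal" where
  "hausdorff_dim A = Inf {ereal s | s. 0 < s \<and> hausdorff_measure s A = 0}"

text \<open>
  Inserting \<open>1\<close> only matters when no \<open>\<theta> \<ge> 1\<close> qualifies, where the type is \<open>1\<close> by convention.
\<close>

definition dioph_type :: "real \<Rightarrow> ereal" where
  "dioph_type \<alpha> =
     Sup (insert 1 {ereal \<theta> | \<theta>. 1 \<le> \<theta> \<and>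
       liminf (\<lambda>n. ereal (real n powr \<theta> * dist_int (real n * \<alpha>))) = 0})"

definition E_set :: "(nat \<Rightarrow> real) \<Rightarrow> real \<Rightarrow> real set" where
  "E_set \<phi> \<alpha> = {y. infinite {n. 1 \<le> n \<and> dist_int (real n * \<alpha> - y) < \<phi> n}}"

definition u_exp :: "(nat \<Rightarrow> real) \<Rightarrow> ereal" where
  "u_exp \<phi> = limsup (\<lambda>n. ereal (ln (real n) / - ln (\<phi> n)))"

text \<open>
  The type \<^typ>\<open>ereal\<close> already implements the conventions for the reciprocal of \<^const>\<open>u_exp\<close>.
\<close>

lemma "1 / (0 :: ereal) = \<infinity>" and "1 / (\<infinity> :: ereal) = 0"
  by simp_all

end

theory Submission
  imports Defs "HOL-Analysis.Kronecker_Approximation_Theorem"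
begin

text \<open>
  Let \<open>u = u_exp \<phi>\<close>. For \<open>s > u\<close> the series of the \<open>\<phi> n powr s\<close> converges, so the intervals of
  radius \<open>\<phi> n\<close> about the points \<open>n\<alpha>\<close> (modulo one) show that the set is null in dimension \<open>s\<close>
  (\<open>hausdorff_measure_E_set_eq_0\<close>). This bound holds without any condition on the Diophantine type.

  For the lower bound let \<open>0 < t < s < u\<close>. Then \<open>\<phi> N > N powr (- 1 / s)\<close> for infinitely many
  \<open>N\<close>, and for such an \<open>N\<close> monotonicity of \<open>\<phi>\<close> makes \<open>N powr (- 1 / s)\<close> an admissible radius
  about every \<open>n\<alpha>\<close> with \<open>n \<le> N\<close>. Since \<open>1 / s > 1 / u\<close> and \<open>1 / u\<close> is at least the
  Diophantine type, the distance from \<open>n\<alpha>\<close> to the nearest integer is at least \<open>c * n powr (- 1 / s)\<close>. Hence an arc of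
  length of order \<open>\<rho>\<close> contains at most \<open>1 + O(N * \<rho> powr s)\<close> of the points \<open>n\<alpha>\<close>, \<open>n \<le> N\<close>
  (\<open>card_visits_le_of_badly_approx\<close>), while for fixed \<open>\<rho>\<close> and large \<open>N\<close> their number is of order
  \<open>N * \<rho>\<close> (\<open>card_visits_ge\<close>, \<open>card_visits_le_length\<close>).

  A set that is null in dimension \<open>t\<close> has a cover of very small total \<open>t\<close>-cost. The lower bound
  does not construct a measure: it constructs a point of the set that such a cover misses, as the
  intersection of nested balls. The invariant is that the members of the cover meeting the current
  ball of radius \<open>r\<close> have total cost at most \<open>r powr t / 512\<close>; as the radii tend to zero, no member
  can contain the limit point. The heart of the proof is \<open>nested_ball_step\<close>: among the balls of
  radius of order \<open>N powr (- 1 / s)\<close> about the points \<open>n\<alpha>\<close> inside the current ball, one again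
  satisfies the invariant. This follows by averaging over these balls, the counting bounds
  limiting how many of them a given member of the cover can meet.
\<close>

section \<open>Distance to the nearest integer\<close>

lemma dist_int_nonneg: "0 \<le> dist_int x"
  by (simp add: dist_int_def)

lemma dist_int_le_dist_of_int: "dist_int x \<le> \<bar>x - of_int m\<bar>"
  unfolding dist_int_def by (rule round_diff_minimal)

lemma dist_int_triangle: "dist_int (x + y) \<le> dist_int x + dist_int y"
proof -
  have "dist_int (x + y) \<le> \<bar>(x + y) - of_int (round x + round y)\<bar>"
    by (rule dist_int_le_dist_of_int)
  also have "\<dots> \<le> dist_int x + dist_int y"
    using abs_triangle_ineq[of "x - of_int (round x)" "y - of_int (round y)"]
    by (simp add: dist_int_def algebra_simps)
  finally show ?thesis .
qed

lemma dist_int_minus: "dist_int (- x) = dist_int x"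
proof -
  have "dist_int (- x) \<le> dist_int x" for x
  proof -
    have "\<bar>- x - of_int (- round x)\<bar> = \<bar>x - of_int (round x)\<bar>"
      by (simp only: of_int_minus)
    then show ?thesis
      using dist_int_le_dist_of_int[of "- x" "- round x"] by (simp add: dist_int_def)
  qed
  from this[of x] this[of "- x"] show ?thesis by simp
qed

lemma dist_int_diff_triangle: "dist_int (x - z) \<le> dist_int (x - y) + dist_int (y - z)"
  using dist_int_triangle[of "x - y" "y - z"] by simp

lemma dist_int_diff_commute: "dist_int (x - y) = dist_int (y - x)"
  using dist_int_minus[of "x - y"] by simp

lemma dist_int_irrational_pos:
  assumes "\<alpha> \<notin> \<rat>" and "1 \<le> n"
  shows "0 < dist_int (real n * \<alpha>)"
proof -
  have "dist_int (real n * \<alpha>) \<noteq> 0"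
  proof
    assume "dist_int (real n * \<alpha>) = 0"
    then have "\<alpha> = of_int (round (real n * \<alpha>)) / of_nat n"
      using assms(2) by (simp add: dist_int_def field_simps)
    then have "\<alpha> \<in> \<rat>"
      by (metis Rats_divide Rats_of_int Rats_of_nat)
    with assms(1) show False by simp
  qed
  then show ?thesis using dist_int_nonneg[of "real n * \<alpha>"] by linarith
qed

section \<open>Counting the orbit of an irrational rotation\<close>

text \<open>The indices \<open>1 \<le> n \<le> N\<close> for which \<open>n\<alpha>\<close> is, modulo one, within \<open>\<rho>\<close> of \<open>y\<close>.\<close>

definition visits :: "real \<Rightarrow> real \<Rightarrow> real \<Rightarrow> nat \<Rightarrow> nat set" where
  "visits \<alpha> y \<rho> N = {n \<in> {1..N}. dist_int (real n * \<alpha> - y) \<le> \<rho>}"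

lemma finite_visits [simp]: "finite (visits \<alpha> y \<rho> N)"
  by (simp add: visits_def)

lemma card_visits_le: "card (visits \<alpha> y \<rho> N) \<le> N"
proof -
  have "card (visits \<alpha> y \<rho> N) \<le> card {1..N}"
    by (intro card_mono) (auto simp: visits_def)
  then show ?thesis by simp
qed

text \<open>Two visits to the same short arc differ by an \<open>m\<close> for which \<open>m\<alpha>\<close> is close to an integer,
  so a lower bound on \<open>dist_int (m * \<alpha>)\<close> forces a minimal time between visits.\<close>

lemma card_visits_le_of_badly_approx:
  assumes "0 < s" "0 < c" "0 < \<rho>"
    and bad: "\<And>n. 1 \<le> n \<Longrightarrow> c * real n powr (- (1 / s)) \<le> dist_int (real n * \<alpha>)"
  shows "real (card (visits \<alpha> y \<rho> N)) \<le> 1 + real N * (2 * \<rho> / c) powr s"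
proof -
  define g where "g = (c / (2 * \<rho>)) powr s"
  have g: "0 < g" using assms by (simp add: g_def)
  have gap: "g \<le> real (n - m)" if "n \<in> visits \<alpha> y \<rho> N" "m \<in> visits \<alpha> y \<rho> N" "m < n" for n m
  proof -
    have "dist_int (real (n - m) * \<alpha>) = dist_int (real n * \<alpha> - real m * \<alpha>)"
      using that by (simp add: of_nat_diff algebra_simps)
    also have "\<dots> \<le> dist_int (real n * \<alpha> - y) + dist_int (y - real m * \<alpha>)"
      by (rule dist_int_diff_triangle)
    also have "\<dots> \<le> 2 * \<rho>"
      using that by (simp add: visits_def dist_int_diff_commute[of y])
    finally have close: "dist_int (real (n - m) * \<alpha>) \<le> 2 * \<rho>" .
    have "1 \<le> n - m" using that by linarith
    from order_trans[OF bad[OF this] close]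
    have "c * real (n - m) powr (- (1 / s)) \<le> 2 * \<rho>" .
    moreover have pos: "0 < real (n - m)" using that by simp
    ultimately have "c / (2 * \<rho>) \<le> real (n - m) powr (1 / s)"
      using assms by (simp add: powr_minus field_simps)
    then have "g \<le> (real (n - m) powr (1 / s)) powr s"
      unfolding g_def using assms by (intro powr_mono2) auto
    then show ?thesis using assms pos by (simp add: powr_powr)
  qed
  have inj: "inj_on (\<lambda>n. nat \<lfloor>real n / g\<rfloor>) (visits \<alpha> y \<rho> N)"
  proof (rule linorder_inj_onI')
    fix m n assume mn: "m \<in> visits \<alpha> y \<rho> N" "n \<in> visits \<alpha> y \<rho> N" "m < n"
    have "(real m + g) / g \<le> real n / g"
      using gap[OF mn(2,1,3)] g mn(3) by (intro divide_right_mono) (auto simp: of_nat_diff)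
    then have "real m / g + 1 \<le> real n / g"
      using g by (simp add: add_divide_distrib)
    then have "\<lfloor>real m / g\<rfloor> < \<lfloor>real n / g\<rfloor>" by linarith
    moreover have "0 \<le> \<lfloor>real m / g\<rfloor>" using g by simp
    ultimately show "nat \<lfloor>real m / g\<rfloor> \<noteq> nat \<lfloor>real n / g\<rfloor>" by linarith
  qed
  have "(\<lambda>n. nat \<lfloor>real n / g\<rfloor>) ` visits \<alpha> y \<rho> N \<subseteq> {..nat \<lfloor>real N / g\<rfloor>}"
    using g by (auto simp: visits_def intro!: nat_mono floor_mono divide_right_mono)
  then have "card (visits \<alpha> y \<rho> N) \<le> card {..nat \<lfloor>real N / g\<rfloor>}"
    using card_inj_on_le[OF inj] by blast
  then have "real (card (visits \<alpha> y \<rho> N)) \<le> 1 + real (nat \<lfloor>real N / g\<rfloor>)" by simp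
  also have "real (nat \<lfloor>real N / g\<rfloor>) \<le> real N / g" using g by simp
  also have "real N / g = real N * (2 * \<rho> / c) powr s"
    using assms by (simp add: g_def powr_divide)
  finally show ?thesis by simp
qed

text \<open>Uniform density: the number of steps needed does not depend on the target \<open>x\<close>.\<close>

lemma orbit_dense_in_bounded_time:
  assumes "\<alpha> \<notin> \<rat>" "0 < \<epsilon>"
  obtains M where "\<And>x. \<exists>m\<le>M. dist_int (real m * \<alpha> - x) \<le> \<epsilon>"
proof -
  obtain K :: nat where K: "0 < K" "1 / real K < \<epsilon> / 2"
    using real_arch_inverse[of "\<epsilon> / 2"] assms by (auto simp: inverse_eq_divide)
  have "\<exists>m. \<bar>frac (real m * \<alpha>) - real j / real K\<bar> < \<epsilon> / 2" if "j \<le> K" for j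
  proof -
    obtain m where "\<bar>frac (real m * \<alpha>) - real j / real K\<bar> < \<epsilon> / 2"
      by (rule Kronecker_approx_1_explicit[OF assms(1), of "real j / real K" "\<epsilon> / 2"])
        (use assms K \<open>j \<le> K\<close> in auto)
    then show ?thesis by blast
  qed
  then obtain f where f: "\<And>j. j \<le> K \<Longrightarrow> \<bar>frac (real (f j) * \<alpha>) - real j / real K\<bar> < \<epsilon> / 2"
    by metis
  have "\<exists>m\<le>(\<Sum>j\<le>K. f j). dist_int (real m * \<alpha> - x) \<le> \<epsilon>" for x
  proof -
    define j where "j = nat \<lfloor>real K * frac x\<rfloor>"
    have j: "real j \<le> real K * frac x" "real K * frac x < real j + 1"
      using K by (auto simp: j_def frac_ge_0)
    have "real K * frac x \<le> real K * 1" using frac_lt_1[of x] by (intro mult_left_mono) auto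
    then have jK: "j \<le> K" using j by linarith
    have "\<bar>real j / real K - frac x\<bar> \<le> 1 / real K"
    proof -
      have "\<bar>real j - real K * frac x\<bar> \<le> 1" using j by linarith
      then have "real K * \<bar>real j / real K - frac x\<bar> \<le> 1"
        using K by (simp add: abs_mult_pos' right_diff_distrib)
      then show ?thesis using K by (simp add: field_simps)
    qed
    then have "\<bar>frac (real (f j) * \<alpha>) - frac x\<bar> \<le> \<epsilon>"
      using f[OF jK] K by linarith
    moreover have "dist_int (real (f j) * \<alpha> - x)
        \<le> \<bar>(real (f j) * \<alpha> - x) - of_int (\<lfloor>real (f j) * \<alpha>\<rfloor> - \<lfloor>x\<rfloor>)\<bar>"
      by (rule dist_int_le_dist_of_int)
    ultimately have "dist_int (real (f j) * \<alpha> - x) \<le> \<epsilon>"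
      by (simp add: frac_def algebra_simps)
    moreover have "f j \<le> (\<Sum>j\<le>K. f j)"
      using jK by (intro member_le_sum) auto
    ultimately show ?thesis by blast
  qed
  then show ?thesis by (rule that)
qed

text \<open>Each arc of length \<open>1 / K\<close> about a point \<open>j / K\<close> is carried into the given arc by a rotation \<open>m\<alpha>\<close> with
  \<open>m\<close> bounded, so none of them is visited much more often than the given arc.\<close>

lemma card_visits_ge:
  assumes "\<alpha> \<notin> \<rat>" "0 < \<rho>" "\<rho> \<le> 1"
  shows "\<exists>N0. \<forall>N\<ge>N0. \<forall>x. real N * \<rho> / 4 \<le> real (card {n \<in> visits \<alpha> x \<rho> N. P < n})"
proof -
  obtain M where M: "\<And>x. \<exists>m\<le>M. dist_int (real m * \<alpha> - x) \<le> \<rho> / 2"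
    using orbit_dense_in_bounded_time[OF assms(1), of "\<rho> / 2"] assms(2) by auto
  define K where "K = nat \<lceil>1 / \<rho>\<rceil>"
  have K1: "1 / \<rho> \<le> real K" unfolding K_def by linarith
  have "1 \<le> 1 / \<rho>" using assms by simp
  then have K2: "real K \<le> 2 / \<rho>" unfolding K_def by linarith
  have K0: "0 < real K" using K1 \<open>1 \<le> 1 / \<rho>\<close> by linarith
  have "real N * \<rho> / 4 \<le> real (card {n \<in> visits \<alpha> x \<rho> N. P < n})"
    if N: "4 * (M + P) \<le> N" for N x
  proof -
    let ?V = "{n \<in> visits \<alpha> x \<rho> N. P < n}"
    define C where "C j = {n \<in> {P<..N - M}. dist_int (real n * \<alpha> - real j / real K) \<le> 1 / (2 * real K)}" for j
    have cover: "{P<..N - M} \<subseteq> (\<Union>j\<le>K. C j)"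
    proof
      fix n assume n: "n \<in> {P<..N - M}"
      let ?f = "frac (real n * \<alpha>)"
      define j where "j = nat \<lfloor>real K * ?f + 1 / 2\<rfloor>"
      have fl: "0 \<le> real K * ?f" using K0 by (simp add: frac_ge_0)
      have j: "real j \<le> real K * ?f + 1 / 2" "real K * ?f < real j + 1 / 2"
        using fl unfolding j_def by linarith+
      have "real K * ?f \<le> real K * 1" using frac_lt_1[of "real n * \<alpha>"] by (intro mult_left_mono) auto
      then have jK: "j \<le> K" using j by linarith
      have "dist_int (real n * \<alpha> - real j / real K)
          \<le> \<bar>(real n * \<alpha> - real j / real K) - of_int \<lfloor>real n * \<alpha>\<rfloor>\<bar>"
        by (rule dist_int_le_dist_of_int)
      also have "\<dots> = \<bar>?f - real j / real K\<bar>" by (simp add: frac_def algebra_simps)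
      also have "\<dots> \<le> 1 / (2 * real K)"
      proof -
        have "\<bar>real K * ?f - real j\<bar> \<le> 1 / 2" using j by linarith
        then have "real K * \<bar>?f - real j / real K\<bar> \<le> 1 / 2"
          using K0 by (simp add: abs_mult_pos' right_diff_distrib)
        then show ?thesis using K0 by (simp add: field_simps)
      qed
      finally show "n \<in> (\<Union>j\<le>K. C j)" using n jK by (auto simp: C_def)
    qed
    have card_C: "card (C j) \<le> card ?V" for j
    proof -
      obtain m where m: "m \<le> M" "dist_int (real m * \<alpha> - (x - real j / real K)) \<le> \<rho> / 2"
        using M by blast
      have "(\<lambda>n. n + m) ` C j \<subseteq> ?V"
      proof (rule image_subsetI)
        fix n assume n: "n \<in> C j"
        have "dist_int (real (n + m) * \<alpha> - x)
            = dist_int ((real n * \<alpha> - real j / real K) + (real m * \<alpha> - (x - real j / real K)))"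
          by (simp add: algebra_simps)
        also have "\<dots> \<le> 1 / (2 * real K) + \<rho> / 2"
          using n m(2) by (intro order_trans[OF dist_int_triangle] add_mono) (auto simp: C_def)
        also have "\<dots> \<le> \<rho>"
          using K1 K0 assms(2) by (simp add: field_simps)
        finally show "n + m \<in> ?V"
          using n m(1) by (auto simp: C_def visits_def)
      qed
      then have "card ((\<lambda>n. n + m) ` C j) \<le> card ?V"
        by (intro card_mono) auto
      then show ?thesis by (simp add: card_image)
    qed
    have "real (N - M - P) = real (card {P<..N - M})" by simp
    also have "\<dots> \<le> real (card (\<Union>j\<le>K. C j))"
      using cover by (intro of_nat_mono card_mono) (auto simp: C_def)
    also have "\<dots> \<le> real (\<Sum>j\<le>K. card (C j))"
      by (intro of_nat_mono card_UN_le) simp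
    also have "\<dots> \<le> real (\<Sum>j\<le>K. card ?V)"
      using card_C by (intro of_nat_mono sum_mono)
    also have "\<dots> = (real K + 1) * real (card ?V)" by (simp add: algebra_simps)
    also have "\<dots> \<le> (3 / \<rho>) * real (card ?V)"
      using K2 \<open>1 \<le> 1 / \<rho>\<close> by (intro mult_right_mono) auto
    finally have "real (N - M - P) * \<rho> / 3 \<le> real (card ?V)"
      using assms(2) by (simp add: field_simps)
    moreover have "real N * (3 / 4) \<le> real (N - M - P)"
    proof -
      define D where "D = N - M - P"
      have "N = D + M + P" using N by (simp add: D_def)
      moreover have "3 * N \<le> 4 * D" using N by (simp add: D_def)
      ultimately show ?thesis unfolding D_def[symmetric] by linarith
    qed
    then have "real N * (3 / 4) * \<rho> \<le> real (N - M - P) * \<rho>"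
      using assms(2) by (intro mult_right_mono) auto
    ultimately show ?thesis by simp
  qed
  then show ?thesis by blast
qed

text \<open>The short arc is carried by bounded rotations into each of \<open>K\<close> disjoint arcs of length
  \<open>1 / K\<close>, so it is visited at most about as often as the average of these.\<close>

lemma card_visits_le_length:
  assumes "\<alpha> \<notin> \<rat>" "0 < \<rho>\<^sub>0"
  shows "\<exists>N0. \<forall>N\<ge>N0. \<forall>\<rho>\<ge>\<rho>\<^sub>0. \<forall>y. real (card (visits \<alpha> y \<rho> N)) \<le> 16 * \<rho> * real N"
proof -
  obtain M where M: "\<And>x. \<exists>m\<le>M. dist_int (real m * \<alpha> - x) \<le> \<rho>\<^sub>0"
    using orbit_dense_in_bounded_time[OF assms] by auto
  have "real (card (visits \<alpha> y \<rho> N)) \<le> 16 * \<rho> * real N"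
    if N: "M \<le> N" and \<rho>: "\<rho>\<^sub>0 \<le> \<rho>" for N \<rho> y
  proof (cases "1 / 16 \<le> \<rho>")
    case True
    have "real (card (visits \<alpha> y \<rho> N)) \<le> 1 * real N" using card_visits_le by simp
    also have "\<dots> \<le> (16 * \<rho>) * real N" using True by (intro mult_right_mono) auto
    finally show ?thesis by simp
  next
    case False
    have \<rho>0: "0 < \<rho>" using \<rho> assms by linarith
    \<comment> \<open>The largest integer below \<open>1 / (4 * \<rho>)\<close>, so that a rotated arc of half-length at most
      \<open>2 * \<rho>\<close> about a centre stays strictly inside its cell.\<close>
    define K where "K = nat (\<lceil>1 / (4 * \<rho>)\<rceil> - 1)"
    have big: "4 < 1 / (4 * \<rho>)" using False \<rho>0 by (simp add: field_simps)
    have K1: "real K < 1 / (4 * \<rho>)" using big unfolding K_def by linarith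
    have K2: "1 / (4 * \<rho>) \<le> real K + 1" using big unfolding K_def by linarith
    have "real K \<ge> 1 / (8 * \<rho>)" using K2 big by (simp add: field_simps)
    have K0: "0 < real K" using K2 big by linarith
    define C where "C j = {n \<in> {1..N + M}. dist_int (real n * \<alpha> - real j / real K) < 1 / (2 * real K)}" for j
    have disj: "C i \<inter> C j = {}" if ij: "i < K" "j < K" "i < j" for i j
    proof (rule ccontr)
      assume "C i \<inter> C j \<noteq> {}"
      then obtain n where n: "dist_int (real n * \<alpha> - real i / real K) < 1 / (2 * real K)"
        "dist_int (real n * \<alpha> - real j / real K) < 1 / (2 * real K)"
        by (auto simp: C_def)
      define d where "d = (real j - real i) / real K"
      have d_eq: "real j / real K - real i / real K = d" by (simp add: d_def diff_divide_distrib)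
      have "dist_int d \<le> dist_int (real j / real K - real n * \<alpha>) + dist_int (real n * \<alpha> - real i / real K)"
        unfolding d_eq[symmetric] by (rule dist_int_diff_triangle)
      also have "\<dots> < 1 / real K"
        using n by (simp add: dist_int_diff_commute[of "real j / real K"])
      finally have lt: "\<bar>d - of_int (round d)\<bar> < 1 / real K" by (simp add: dist_int_def)
      have d1: "1 / real K \<le> d"
        using ij K0 by (simp add: d_def field_simps)
      have "real j + 1 \<le> real K" using ij by linarith
      then have "d \<le> (real K - 1) / real K"
        using K0 unfolding d_def by (intro divide_right_mono) auto
      then have d2: "d \<le> 1 - 1 / real K"
        using K0 by (simp add: diff_divide_distrib)
      have r: "0 < real_of_int (round d)" "real_of_int (round d) < 1" using lt d1 d2 by linarith+
      then show False by simp
    qed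
    have le: "card (visits \<alpha> y \<rho> N) \<le> card (C j)" for j
    proof -
      obtain m where m: "m \<le> M" "dist_int (real m * \<alpha> - (real j / real K - y)) \<le> \<rho>\<^sub>0"
        using M by blast
      have "(\<lambda>n. n + m) ` visits \<alpha> y \<rho> N \<subseteq> C j"
      proof (rule image_subsetI)
        fix n assume n: "n \<in> visits \<alpha> y \<rho> N"
        have "dist_int (real (n + m) * \<alpha> - real j / real K)
            = dist_int ((real n * \<alpha> - y) + (real m * \<alpha> - (real j / real K - y)))"
          by (simp add: algebra_simps)
        also have "\<dots> \<le> \<rho> + \<rho>\<^sub>0"
          using n m(2) by (intro order_trans[OF dist_int_triangle] add_mono) (auto simp: visits_def)
        also have "\<dots> \<le> 2 * \<rho>" using \<rho> by simp
        also have "\<dots> < 1 / (2 * real K)"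
          using K1 K0 \<rho>0 by (simp add: field_simps)
        finally show "n + m \<in> C j"
          using n m(1) by (auto simp: C_def visits_def)
      qed
      then have "card ((\<lambda>n. n + m) ` visits \<alpha> y \<rho> N) \<le> card (C j)"
        by (intro card_mono) (auto simp: C_def)
      then show ?thesis by (simp add: card_image)
    qed
    have "K * card (visits \<alpha> y \<rho> N) = (\<Sum>j<K. card (visits \<alpha> y \<rho> N))" by simp
    also have "\<dots> \<le> (\<Sum>j<K. card (C j))" using le by (intro sum_mono)
    also have "\<dots> = card (\<Union>j<K. C j)"
    proof (rule card_UN_disjoint[symmetric])
      show "\<forall>j\<in>{..<K}. finite (C j)" by (simp add: C_def)
      show "\<forall>i\<in>{..<K}. \<forall>j\<in>{..<K}. i \<noteq> j \<longrightarrow> C i \<inter> C j = {}"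
        using disj by (metis Int_commute lessThan_iff linorder_neqE_nat)
    qed simp
    also have "\<dots> \<le> card {1..N + M}"
      by (intro card_mono) (auto simp: C_def)
    also have "\<dots> \<le> 2 * N" using N by simp
    finally have "real K * real (card (visits \<alpha> y \<rho> N)) \<le> 2 * real N"
      by (metis of_nat_le_iff of_nat_mult of_nat_numeral)
    moreover have "1 / (8 * \<rho>) * real (card (visits \<alpha> y \<rho> N)) \<le> real K * real (card (visits \<alpha> y \<rho> N))"
      using \<open>real K \<ge> 1 / (8 * \<rho>)\<close> by (intro mult_right_mono) auto
    ultimately have "1 / (8 * \<rho>) * real (card (visits \<alpha> y \<rho> N)) \<le> 2 * real N" by linarith
    then show ?thesis using \<rho>0 by (simp add: field_simps)
  qed
  then show ?thesis by blast
qed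

section \<open>Nested balls avoiding a cheap cover\<close>

text \<open>The total \<open>t\<close>-cost of those members of a cover that meet \<open>B\<close>, where \<open>d i\<close> stands for the
  diameter of \<open>U i\<close>.\<close>

definition cover_cost :: "(nat \<Rightarrow> 'a set) \<Rightarrow> (nat \<Rightarrow> real) \<Rightarrow> real \<Rightarrow> 'a set \<Rightarrow> real" where
  "cover_cost U d t B = (\<Sum>i. if U i \<inter> B = {} then 0 else d i powr t)"

lemma summable_restrict:
  fixes f :: "nat \<Rightarrow> real"
  assumes "summable f" "\<And>i. 0 \<le> f i"
  shows "summable (\<lambda>i. if P i then 0 else f i)"
  by (rule summable_comparison_test'[OF assms(1), of 0]) (use assms in auto)

lemma powr_le_cover_cost:
  assumes "summable (\<lambda>i. d i powr t)" "U i \<inter> B \<noteq> {}"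
  shows "d i powr t \<le> cover_cost U d t B"
proof -
  have "sum (\<lambda>i. if U i \<inter> B = {} then 0 else d i powr t) {i} \<le> cover_cost U d t B"
    unfolding cover_cost_def
    by (intro sum_le_suminf summable_restrict assms) auto
  then show ?thesis using assms(2) by simp
qed

text \<open>The members of the cover fall into three classes. One of diameter below the new radius \<open>r'\<close>
  meets at most two of the new balls. One of diameter between \<open>r'\<close> and a threshold \<open>l\<close> is controlled
  by the bad approximability of \<open>\<alpha>\<close>, with the gain \<open>l powr (s - t)\<close>. One of diameter at least \<open>l\<close>
  meets a number of new balls proportional to its diameter, which suffices because this diameter is
  at most \<open>r\<close>. The threshold \<open>l\<close> depends on \<open>r\<close>, \<open>s\<close>, \<open>t\<close> and \<open>c\<close> only, and \<open>N\<close> is chosen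
  after it, so that the count for long arcs applies uniformly above \<open>l\<close>.\<close>

lemma nested_ball_step:
  fixes U :: "nat \<Rightarrow> real set"
  assumes irr: "\<alpha> \<notin> \<rat>"
    and t: "0 < t" "t < s" "s \<le> 1"
    and c: "0 < c"
    and bad: "\<And>n. 1 \<le> n \<Longrightarrow> c * real n powr (- (1 / s)) \<le> dist_int (real n * \<alpha>)"
    and inf: "infinite {N. 1 \<le> N \<and> real N powr (- (1 / s)) < \<phi> N}"
    and anti: "antimono_on {1..} \<phi>"
    and U: "\<And>i. bounded (U i)" "\<And>i. diameter (U i) \<le> d i"
    and d: "\<And>i. 0 < d i" "summable (\<lambda>i. d i powr t)"
    and r: "0 < r" "r \<le> 1"
    and cost: "cover_cost U d t (cball x r) \<le> r powr t / 512"
  shows "\<exists>p r' n. P < n \<and> 0 < r' \<and> r' \<le> r / 2 \<and> cball p r' \<subseteq> cball x r \<and>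
           p - real n * \<alpha> \<in> \<int> \<and> r' < \<phi> n \<and> cover_cost U d t (cball p r') \<le> r' powr t / 512"
proof -
  define \<kappa> where "\<kappa> = min (c / 4) (1 / 2)"
  have \<kappa>: "0 < \<kappa>" "\<kappa> < 1" using c by (auto simp: \<kappa>_def)
  have "1 / (c / 4) \<le> 1 / \<kappa>"
    using \<kappa>(1) by (intro divide_left_mono) (auto simp: \<kappa>_def)
  then have \<kappa>': "4 / c \<le> 1 / \<kappa>" by simp
  \<comment> \<open>The threshold below which the gain \<open>l powr (s - t)\<close> outweighs the constants.\<close>
  define l where "l = (\<kappa> powr s * r powr (1 - t)) powr (1 / (s - t))"
  have l: "0 < l" "l powr (s - t) = \<kappa> powr s * r powr (1 - t)"
    using \<kappa> r t by (simp_all add: l_def powr_powr)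
  obtain N1 where N1: "\<And>N. N1 \<le> N \<Longrightarrow>
      real N * (r / 2) / 4 \<le> real (card {n \<in> visits \<alpha> x (r / 2) N. P < n})"
    using card_visits_ge[OF irr, of "r / 2" P] r by auto
  obtain N2 where N2: "\<And>N \<rho> y. N2 \<le> N \<Longrightarrow> l \<le> \<rho> \<Longrightarrow>
      real (card (visits \<alpha> y \<rho> N)) \<le> 16 * \<rho> * real N"
    using card_visits_le_length[OF irr l(1)] by blast
  have "((\<lambda>N. \<kappa> * real N powr (- (1 / s))) \<longlongrightarrow> \<kappa> * 0) sequentially"
    using t by (intro tendsto_intros tendsto_neg_powr filterlim_real_sequentially) auto
  then have ev1: "eventually (\<lambda>N. \<kappa> * real N powr (- (1 / s)) < r / 2) sequentially"
    using r by (intro order_tendstoD(2)[where a = "r / 2"]) auto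
  have "((\<lambda>N. real N powr (- (1 - t / s))) \<longlongrightarrow> 0) sequentially"
    using t by (intro tendsto_neg_powr filterlim_real_sequentially) (auto simp: field_simps)
  then have ev2: "eventually (\<lambda>N. real N powr (- (1 - t / s)) < \<kappa> powr t * r powr (1 - t) / 32) sequentially"
    using \<kappa> r by (intro order_tendstoD(2)[where a = "\<kappa> powr t * r powr (1 - t) / 32"]) auto
  obtain N3 where N3: "\<And>N. N3 \<le> N \<Longrightarrow> \<kappa> * real N powr (- (1 / s)) < r / 2 \<and>
      real N powr (- (1 - t / s)) < \<kappa> powr t * r powr (1 - t) / 32"
    using eventually_conj[OF ev1 ev2] by (auto simp: eventually_sequentially)
  obtain N where "max N1 (max N2 N3) \<le> N" "N \<in> {N. 1 \<le> N \<and> real N powr (- (1 / s)) < \<phi> N}"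
    using inf unfolding infinite_nat_iff_unbounded_le by blast
  then have N: "max N1 (max N2 N3) \<le> N" "1 \<le> N" "real N powr (- (1 / s)) < \<phi> N" by auto
  define r' where "r' = \<kappa> * real N powr (- (1 / s))"
  have r': "0 < r'" "r' \<le> r / 2"
    using N N3[of N] \<kappa> by (auto simp: r'_def)
  have r'_\<phi>: "r' < \<phi> N"
  proof -
    have "r' \<le> 1 * real N powr (- (1 / s))"
      unfolding r'_def using \<kappa> by (intro mult_right_mono) auto
    with N(3) show ?thesis by simp
  qed
  have N_r': "real N * (r' / \<kappa>) powr s = 1"
  proof -
    have "r' / \<kappa> = real N powr (- (1 / s))" using \<kappa> by (simp add: r'_def)
    then have "(r' / \<kappa>) powr s = real N powr (- 1)" using t by (simp add: powr_powr)
    then show ?thesis using N(2) by (simp add: powr_minus)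
  qed
  \<comment> \<open>\<open>W\<close> bounds the charge of a member of the cover, summed over all new balls, per unit of its
    own cost. If at least \<open>N * r / 8\<close> new balls were charged \<open>r' powr t / 512\<close> each, this would exceed \<open>W\<close> times
    the cost \<open>r powr t / 512\<close> that is available.\<close>
  define W where "W = r' powr t * r powr (1 - t) * real N / 16"
  have W2: "2 \<le> W"
  proof -
    have "real N powr (- (1 - t / s)) * real N powr (1 - t / s)
        \<le> (\<kappa> powr t * r powr (1 - t) / 32) * real N powr (1 - t / s)"
      using N3[of N] N(1) by (intro mult_right_mono) auto
    moreover have "real N powr (- (1 - t / s)) * real N powr (1 - t / s) = 1"
      using N(2) unfolding powr_add[symmetric] by simp
    ultimately have "32 \<le> real N powr (1 - t / s) * (\<kappa> powr t * r powr (1 - t))"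
      by (simp add: mult_ac)
    moreover have "real N * (real N powr (- (1 / s))) powr t = real N powr (1 - t / s)"
    proof -
      have "real N * (real N powr (- (1 / s))) powr t = real N powr 1 * real N powr (- (t / s))"
        using N(2) by (simp add: powr_powr)
      also have "\<dots> = real N powr (1 - t / s)"
        unfolding powr_add[symmetric] by simp
      finally show ?thesis .
    qed
    ultimately have "32 \<le> (real N * (real N powr (- (1 / s))) powr t) * (\<kappa> powr t * r powr (1 - t))"
      by simp
    then show ?thesis
      using \<kappa> by (simp add: W_def r'_def powr_mult mult_ac)
  qed
  define S where "S = {n \<in> visits \<alpha> x (r / 2) N. P < n}"
  \<comment> \<open>The translate of \<open>n\<alpha>\<close> by an integer that is nearest to \<open>x\<close>.\<close>
  define p where "p n = real n * \<alpha> - of_int (round (real n * \<alpha> - x))" for n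
  have finS: "finite S" by (simp add: S_def)
  have p_int: "p n - real n * \<alpha> \<in> \<int>" for n by (simp add: p_def)
  have p_x: "\<bar>p n - x\<bar> \<le> r / 2" if "n \<in> S" for n
    using that by (simp add: S_def visits_def dist_int_def p_def algebra_simps)
  have sub: "cball (p n) r' \<subseteq> cball x r" if "n \<in> S" for n
  proof
    fix y assume "y \<in> cball (p n) r'"
    then show "y \<in> cball x r"
      using p_x[OF that] r'(2) dist_triangle2[of x y "p n"]
      by (simp add: dist_commute[of _ "p n"] dist_real_def[of "p n" x])
  qed
  \<comment> \<open>Capping the cost of each member at \<open>r' powr t / 512\<close> still leaves a total of at least this
    amount on every new ball that violates the invariant, but limits what a large member
    contributes.\<close>
  define e where "e i = min (d i powr t) (r' powr t / 512)" for i
  have e: "0 \<le> e i" "e i \<le> d i powr t" "e i \<le> r' powr t / 512" for i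
    by (auto simp: e_def)
  have sum_e: "summable e"
    by (rule summable_comparison_test'[OF d(2), of 0]) (use e in auto)
  define touch where "touch i n = (if U i \<inter> cball (p n) r' = {} then 0 else e i)" for i n
  have sum_touch: "summable (\<lambda>i. touch i n)" for n
    unfolding touch_def by (intro summable_restrict sum_e e)
  have d_le_r: "d i \<le> r" if "U i \<inter> cball x r \<noteq> {}" for i
  proof -
    have "d i powr t \<le> cover_cost U d t (cball x r)"
      using that by (rule powr_le_cover_cost[OF d(2)])
    also have "\<dots> \<le> r powr t" using cost powr_ge_zero[of r t] by linarith
    finally have "\<not> r < d i"
      using powr_less_mono2[of t r "d i"] t r by auto
    then show ?thesis by simp
  qed
  have per_index: "(\<Sum>n\<in>S. touch i n) \<le> W * (if U i \<inter> cball x r = {} then 0 else d i powr t)" for i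
  proof (cases "U i \<inter> cball x r = {}")
    case True
    then have "touch i n = 0" if "n \<in> S" for n
      using sub[OF that] by (auto simp: touch_def)
    then show ?thesis using True by simp
  next
    case False
    then obtain u where u: "u \<in> U i" by blast
    define m where "m = real (card (visits \<alpha> u (d i + r') N))"
    have "(\<Sum>n\<in>S. touch i n) = real (card {n \<in> S. U i \<inter> cball (p n) r' \<noteq> {}}) * e i"
      unfolding touch_def by (subst sum.If_cases[OF finS]) (simp add: Int_def)
    also have "\<dots> \<le> m * e i"
    proof -
      have "{n \<in> S. U i \<inter> cball (p n) r' \<noteq> {}} \<subseteq> visits \<alpha> u (d i + r') N"
      proof
        fix n assume "n \<in> {n \<in> S. U i \<inter> cball (p n) r' \<noteq> {}}"
        then obtain y where n: "n \<in> S" and y: "y \<in> U i" "y \<in> cball (p n) r'" by blast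
        have "dist u y \<le> d i"
          using diameter_bounded_bound[OF U(1) u y(1)] U(2)[of i] by linarith
        then have "\<bar>p n - u\<bar> \<le> d i + r'"
          using y(2) dist_triangle2[of "p n" u y]
          by (simp add: dist_real_def[of "p n" u])
        moreover have "dist_int (real n * \<alpha> - u) \<le> \<bar>p n - u\<bar>"
          using dist_int_le_dist_of_int[of "real n * \<alpha> - u" "round (real n * \<alpha> - x)"]
          by (simp add: p_def algebra_simps)
        ultimately show "n \<in> visits \<alpha> u (d i + r') N"
          using n by (simp add: S_def visits_def)
      qed
      then show ?thesis
        unfolding m_def by (intro mult_right_mono of_nat_mono card_mono e) auto
    qed
    also have "m * e i \<le> W * d i powr t"
    proof -
      have count: "m \<le> 1 + real N * (v / \<kappa>) powr s" if v: "d i \<le> v" "r' \<le> v" for v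
      proof -
        have "m \<le> 1 + real N * (2 * (d i + r') / c) powr s"
          unfolding m_def
          by (rule card_visits_le_of_badly_approx[OF _ c _ bad]) (use t d(1)[of i] r' in auto)
        moreover have "(2 * (d i + r') / c) powr s \<le> (v / \<kappa>) powr s"
        proof (rule powr_mono2)
          have "2 * (d i + r') / c \<le> 4 * v / c"
            using v c by (intro divide_right_mono) auto
          also have "\<dots> = v * (4 / c)" by simp
          also have "\<dots> \<le> v * (1 / \<kappa>)"
            using \<kappa>' v r' by (intro mult_left_mono) auto
          finally show "2 * (d i + r') / c \<le> v / \<kappa>" by simp
        qed (use t c d(1)[of i] r' in auto)
        ultimately show ?thesis
          by (meson add_left_mono mult_left_mono of_nat_0_le_iff order_trans)
      qed
      have m0: "0 \<le> m" by (simp add: m_def)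
      consider "d i < r'" | "r' \<le> d i" "d i < l" | "r' \<le> d i" "l \<le> d i" by linarith
      then show ?thesis
      proof cases
        case 1
        then have "m \<le> 2" using count[of r'] N_r' by simp
        then have "m * e i \<le> 2 * d i powr t"
          using e[of i] by (intro mult_mono) auto
        also have "\<dots> \<le> W * d i powr t" using W2 by (intro mult_right_mono) auto
        finally show ?thesis .
      next
        case 2
        have "1 \<le> real N * (d i / \<kappa>) powr s"
          unfolding N_r'[symmetric] using 2 r' \<kappa> t
          by (intro mult_left_mono powr_mono2 divide_right_mono) auto
        then have m_le: "m \<le> 2 * (real N * (d i / \<kappa>) powr s)"
          using count[of "d i"] 2 by simp
        have "(d i / \<kappa>) powr s = d i powr t * d i powr (s - t) / \<kappa> powr s"
          using d(1)[of i] \<kappa> by (simp add: powr_divide flip: powr_add)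
        also have "\<dots> \<le> d i powr t * l powr (s - t) / \<kappa> powr s"
          using 2 d(1)[of i] t by (intro divide_right_mono mult_left_mono powr_mono2) auto
        also have "\<dots> = d i powr t * r powr (1 - t)"
          using \<kappa> by (simp add: l)
        finally have "real N * (d i / \<kappa>) powr s \<le> real N * (d i powr t * r powr (1 - t))"
          by (rule mult_left_mono) simp
        with m_le have "m \<le> 2 * (real N * (d i powr t * r powr (1 - t)))" by linarith
        then have "m * e i \<le> 2 * (real N * (d i powr t * r powr (1 - t))) * (r' powr t / 512)"
          using e[of i] by (intro mult_mono) auto
        also have "\<dots> = W * d i powr t / 16" by (simp add: W_def)
        also have "\<dots> \<le> W * d i powr t" using W2 by simp
        finally show ?thesis .
      next
        case 3
        have "m \<le> 16 * (d i + r') * real N"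
          unfolding m_def using N(1) 3 r' by (intro N2) auto
        also have "\<dots> \<le> 16 * (2 * d i) * real N"
          using 3 by (intro mult_right_mono) auto
        also have "\<dots> = 16 * (2 * (d i powr (1 - t) * d i powr t)) * real N"
        proof -
          have "d i powr (1 - t) * d i powr t = d i"
            using d(1)[of i] by (simp flip: powr_add)
          then show ?thesis by simp
        qed
        also have "\<dots> \<le> 16 * (2 * (r powr (1 - t) * d i powr t)) * real N"
          using d_le_r[OF False] d(1)[of i] t
          by (intro mult_right_mono mult_left_mono powr_mono2) auto
        finally have "m \<le> 16 * (2 * (r powr (1 - t) * d i powr t)) * real N" .
        then have "m * e i \<le> 16 * (2 * (r powr (1 - t) * d i powr t)) * real N * (r' powr t / 512)"
          using e[of i] by (intro mult_mono) auto
        also have "\<dots> = W * d i powr t" by (simp add: W_def)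
        finally show ?thesis .
      qed
    qed
    finally show ?thesis using False by simp
  qed
  have "\<exists>n\<in>S. cover_cost U d t (cball (p n) r') \<le> r' powr t / 512"
  proof (rule ccontr)
    assume "\<not> ?thesis"
    then have over: "r' powr t / 512 < cover_cost U d t (cball (p n) r')" if "n \<in> S" for n
      using that by force
    have "r' powr t / 512 \<le> (\<Sum>i. touch i n)" if n: "n \<in> S" for n
    proof (cases "\<exists>i. U i \<inter> cball (p n) r' \<noteq> {} \<and> r' powr t / 512 \<le> d i powr t")
      case True
      then obtain i where i: "U i \<inter> cball (p n) r' \<noteq> {}" "r' powr t / 512 \<le> d i powr t" by blast
      then have "r' powr t / 512 = sum (\<lambda>i. touch i n) {i}"
        by (simp add: touch_def e_def)
      also have "\<dots> \<le> (\<Sum>i. touch i n)"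
        by (rule sum_le_suminf[OF sum_touch]) (use e in \<open>auto simp: touch_def\<close>)
      finally show ?thesis .
    next
      case False
      then have "touch i n = (if U i \<inter> cball (p n) r' = {} then 0 else d i powr t)" for i
        by (auto simp: touch_def e_def)
      then show ?thesis
        using over[OF n] by (simp add: cover_cost_def)
    qed
    then have "(\<Sum>n\<in>S. r' powr t / 512) \<le> (\<Sum>n\<in>S. \<Sum>i. touch i n)"
      by (rule sum_mono)
    also have "\<dots> = (\<Sum>i. \<Sum>n\<in>S. touch i n)"
      using sum_touch by (intro suminf_sum[symmetric])
    also have "\<dots> \<le> (\<Sum>i. W * (if U i \<inter> cball x r = {} then 0 else d i powr t))"
      using sum_touch d(2)
      by (intro suminf_le per_index summable_sum summable_mult summable_restrict) auto
    also have "\<dots> = W * cover_cost U d t (cball x r)"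
      unfolding cover_cost_def using d(2) by (intro suminf_mult summable_restrict) auto
    also have "\<dots> \<le> W * (r powr t / 512)"
      using cost W2 by (intro mult_left_mono) auto
    also have "\<dots> = r' powr t * real N / 16 * (r powr (1 - t) * r powr t) / 512"
      by (simp add: W_def)
    also have "r powr (1 - t) * r powr t = r"
      using r by (simp flip: powr_add)
    finally have "real (card S) * (r' powr t) \<le> (real N * r / 16) * (r' powr t)"
      by (simp add: mult_ac)
    then have "real (card S) \<le> real N * r / 16"
      using r'(1) by simp
    moreover have "real N * r / 8 \<le> real (card S)"
      using N1[of N] N(1) by (simp add: S_def)
    moreover have "0 < real N * r" using N(2) r by simp
    ultimately show False by linarith
  qed
  then obtain n where n: "n \<in> S" "cover_cost U d t (cball (p n) r') \<le> r' powr t / 512" by blast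
  have "\<phi> N \<le> \<phi> n"
    using n(1) by (intro monotone_onD[OF anti]) (auto simp: S_def visits_def)
  then have "r' < \<phi> n" using r'_\<phi> by linarith
  moreover have "P < n" using n(1) by (simp add: S_def)
  ultimately show ?thesis using n(2) r' sub[OF n(1)] p_int[of n] by blast
qed

section \<open>Covers and null sets\<close>

lemma hausdorff_measure_eq_0_iff:
  "hausdorff_measure s A = 0 \<longleftrightarrow> (\<forall>\<delta>>0. hausdorff_pre_measure s \<delta> A = 0)"
  unfolding hausdorff_measure_def by (subst SUP_eq_iff[where c = 0]) auto

lemma hausdorff_pre_measure_eq_0_iff:
  "hausdorff_pre_measure s \<delta> A = 0 \<longleftrightarrow>
    (\<forall>\<epsilon>>0. \<exists>U. A \<subseteq> (\<Union>i. U i) \<and> (\<forall>i. bounded (U i) \<and> diameter (U i) \<le> \<delta>) \<and>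
       (\<Sum>i. ennreal (diameter (U i) powr s)) < ennreal \<epsilon>)" (is "?L \<longleftrightarrow> ?R")
proof
  assume ?L
  show ?R
  proof (intro allI impI)
    fix \<epsilon> :: real assume "0 < \<epsilon>"
    then have "hausdorff_pre_measure s \<delta> A < ennreal \<epsilon>" using \<open>?L\<close> by simp
    then show "\<exists>U. A \<subseteq> (\<Union>i. U i) \<and> (\<forall>i. bounded (U i) \<and> diameter (U i) \<le> \<delta>) \<and>
       (\<Sum>i. ennreal (diameter (U i) powr s)) < ennreal \<epsilon>"
      unfolding hausdorff_pre_measure_def Inf_less_iff by auto
  qed
next
  assume R: ?R
  have le: "hausdorff_pre_measure s \<delta> A \<le> ennreal \<epsilon>" if \<epsilon>: "0 < \<epsilon>" for \<epsilon>
  proof -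
    obtain U where U: "A \<subseteq> (\<Union>i. U i)" "\<forall>i. bounded (U i) \<and> diameter (U i) \<le> \<delta>"
      "(\<Sum>i. ennreal (diameter (U i) powr s)) < ennreal \<epsilon>"
      using R \<epsilon> by blast
    have "hausdorff_pre_measure s \<delta> A \<le> (\<Sum>i. ennreal (diameter (U i) powr s))"
      unfolding hausdorff_pre_measure_def
      by (intro Inf_lower CollectI exI[of _ U]) (use U(1,2) in auto)
    then show ?thesis using U(3) by simp
  qed
  have "hausdorff_pre_measure s \<delta> A \<le> 0"
  proof (rule ennreal_le_epsilon)
    fix \<epsilon> :: real assume "0 < \<epsilon>"
    from le[OF this] show "hausdorff_pre_measure s \<delta> A \<le> 0 + ennreal \<epsilon>"
      by (simp only: add_0)
  qed
  then show ?L by simp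
qed

lemma hausdorff_measure_UN_eq_0:
  fixes A :: "nat \<Rightarrow> 'a::metric_space set"
  assumes "\<And>k. hausdorff_measure s (A k) = 0"
  shows "hausdorff_measure s (\<Union>k. A k) = 0"
  unfolding hausdorff_measure_eq_0_iff hausdorff_pre_measure_eq_0_iff
proof (intro allI impI)
  fix \<delta> \<epsilon> :: real assume "0 < \<delta>" "0 < \<epsilon>"
  then have "\<forall>k. \<exists>U. A k \<subseteq> (\<Union>i. U i) \<and> (\<forall>i. bounded (U i) \<and> diameter (U i) \<le> \<delta>) \<and>
       (\<Sum>i. ennreal (diameter (U i) powr s)) < ennreal (\<epsilon> / 2 * (1 / 2) ^ Suc k)"
  proof (intro allI)
    fix k
    have "0 < \<epsilon> / 2 * (1 / 2) ^ Suc k" using \<open>0 < \<epsilon>\<close> by simp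
    with \<open>0 < \<delta>\<close> assms[of k, unfolded hausdorff_measure_eq_0_iff hausdorff_pre_measure_eq_0_iff]
    show "\<exists>U. A k \<subseteq> (\<Union>i. U i) \<and> (\<forall>i. bounded (U i) \<and> diameter (U i) \<le> \<delta>) \<and>
       (\<Sum>i. ennreal (diameter (U i) powr s)) < ennreal (\<epsilon> / 2 * (1 / 2) ^ Suc k)"
      by blast
  qed
  then obtain U where U: "\<And>k. A k \<subseteq> (\<Union>i. U k i)" "\<And>k i. bounded (U k i) \<and> diameter (U k i) \<le> \<delta>"
    "\<And>k. (\<Sum>i. ennreal (diameter (U k i) powr s)) < ennreal (\<epsilon> / 2 * (1 / 2) ^ Suc k)"
    by metis
  define V where "V j = case_prod U (prod_decode j)" for j
  have "(\<Union>k. A k) \<subseteq> (\<Union>j. V j)"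
  proof
    fix x assume "x \<in> (\<Union>k. A k)"
    then obtain k i where "x \<in> U k i" using U(1) by blast
    then have "x \<in> V (prod_encode (k, i))" by (simp add: V_def)
    then show "x \<in> (\<Union>j. V j)" by blast
  qed
  moreover have "bounded (V j) \<and> diameter (V j) \<le> \<delta>" for j
    using U(2) by (simp add: V_def split: prod.split)
  moreover have "(\<Sum>j. ennreal (diameter (V j) powr s)) < ennreal \<epsilon>"
  proof -
    have "(\<Sum>j. ennreal (diameter (V j) powr s))
        = (\<Sum>j. (\<lambda>(k, i). ennreal (diameter (U k i) powr s)) (prod_decode j))"
      by (simp add: V_def case_prod_beta)
    also have "\<dots> = (\<Sum>k. \<Sum>i. ennreal (diameter (U k i) powr s))"
      by (rule suminf_ennreal_2dimen) simp
    also have "\<dots> \<le> (\<Sum>k. ennreal (\<epsilon> / 2 * (1 / 2) ^ Suc k))"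
      using U(3) by (intro suminf_le summableI) (auto intro: less_imp_le)
    also have "\<dots> = ennreal (\<epsilon> / 2)"
      using \<open>0 < \<epsilon>\<close> sums_mult[OF power_half_series, of "\<epsilon> / 2"]
      by (intro suminf_ennreal_eq) auto
    also have "\<dots> < ennreal \<epsilon>" using \<open>0 < \<epsilon>\<close> by (simp add: ennreal_lessI)
    finally show ?thesis .
  qed
  ultimately show "\<exists>U. (\<Union>k. A k) \<subseteq> (\<Union>i. U i) \<and> (\<forall>i. bounded (U i) \<and> diameter (U i) \<le> \<delta>) \<and>
       (\<Sum>i. ennreal (diameter (U i) powr s)) < ennreal \<epsilon>"
    by blast
qed

text \<open>The easy half of the Borel--Cantelli principle for Hausdorff measures: the tails of the
  sequence are covers of arbitrarily small cost.\<close>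

lemma hausdorff_measure_infinitely_often_eq_0:
  fixes B :: "nat \<Rightarrow> 'a::metric_space set"
  assumes s: "0 < s" and B: "\<And>n. bounded (B n)" and sum: "summable (\<lambda>n. diameter (B n) powr s)"
  shows "hausdorff_measure s {y. infinite {n. y \<in> B n}} = 0"
  unfolding hausdorff_measure_eq_0_iff hausdorff_pre_measure_eq_0_iff
proof (intro allI impI)
  fix \<delta> \<epsilon> :: real assume \<delta>: "0 < \<delta>" and \<epsilon>: "0 < \<epsilon>"
  obtain n1 where n1: "\<And>n. n1 \<le> n \<Longrightarrow> norm (\<Sum>i. diameter (B (i + n)) powr s) < \<epsilon>"
    using suminf_exist_split[OF \<epsilon> sum] by blast
  have "eventually (\<lambda>n. diameter (B n) powr s < \<delta> powr s) sequentially"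
    using order_tendstoD(2)[OF summable_LIMSEQ_zero[OF sum]] \<delta> by simp
  then obtain n2 where n2: "\<And>n. n2 \<le> n \<Longrightarrow> diameter (B n) powr s < \<delta> powr s"
    by (auto simp: eventually_sequentially)
  define U where "U i = B (i + max n1 n2)" for i
  have "{y. infinite {n. y \<in> B n}} \<subseteq> (\<Union>i. U i)"
  proof
    fix y assume "y \<in> {y. infinite {n. y \<in> B n}}"
    then obtain n where "max n1 n2 \<le> n" "y \<in> B n"
      unfolding infinite_nat_iff_unbounded_le by blast
    then have "y \<in> U (n - max n1 n2)" by (simp add: U_def)
    then show "y \<in> (\<Union>i. U i)" by blast
  qed
  moreover have "diameter (U i) \<le> \<delta>" for i
  proof (rule ccontr)
    assume "\<not> diameter (U i) \<le> \<delta>"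
    then have "\<delta> powr s < diameter (U i) powr s"
      using s \<delta> by (intro powr_less_mono2) auto
    moreover have "diameter (U i) powr s < \<delta> powr s"
      unfolding U_def by (rule n2) simp
    ultimately show False by simp
  qed
  moreover have "(\<Sum>i. ennreal (diameter (U i) powr s)) < ennreal \<epsilon>"
  proof -
    have "summable (\<lambda>i. diameter (U i) powr s)"
      unfolding U_def by (rule summable_ignore_initial_segment[OF sum])
    then have "(\<Sum>i. ennreal (diameter (U i) powr s)) = ennreal (\<Sum>i. diameter (U i) powr s)"
      by (intro suminf_ennreal2) auto
    also have "\<dots> < ennreal \<epsilon>"
      using n1[of "max n1 n2"] \<epsilon> unfolding U_def by (intro ennreal_lessI) auto
    finally show ?thesis .
  qed
  ultimately show "\<exists>U. {y. infinite {n. y \<in> B n}} \<subseteq> (\<Union>i. U i) \<and>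
       (\<forall>i. bounded (U i) \<and> diameter (U i) \<le> \<delta>) \<and>
       (\<Sum>i. ennreal (diameter (U i) powr s)) < ennreal \<epsilon>"
    using B by (intro exI[of _ U]) (auto simp: U_def)
qed

text \<open>The \<open>d i\<close> are strictly positive even when the members of the cover are points or empty,
  so that a point lying in balls of arbitrarily small cost is missed by the cover.\<close>

lemma null_set_cheap_cover:
  assumes t: "0 < t" and null: "hausdorff_measure t A = 0" and \<epsilon>: "0 < \<epsilon>"
  obtains U :: "nat \<Rightarrow> 'a::metric_space set" and d :: "nat \<Rightarrow> real"
  where "A \<subseteq> (\<Union>i. U i)" "\<And>i. bounded (U i)" "\<And>i. diameter (U i) \<le> d i" "\<And>i. 0 < d i"
    "summable (\<lambda>i. d i powr t)" "(\<Sum>i. d i powr t) \<le> \<epsilon>"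
proof -
  have "hausdorff_pre_measure t 1 A = 0"
    using null unfolding hausdorff_measure_eq_0_iff by simp
  from this[unfolded hausdorff_pre_measure_eq_0_iff, rule_format, OF half_gt_zero[OF \<epsilon>]]
  obtain U where U: "A \<subseteq> (\<Union>i. U i)" "\<And>i. bounded (U i)"
    "(\<Sum>i. ennreal (diameter (U i) powr t)) < ennreal (\<epsilon> / 2)"
    by blast
  have sumU: "summable (\<lambda>i. diameter (U i) powr t)"
  proof (rule summable_suminf_not_top)
    show "(\<Sum>i. ennreal (diameter (U i) powr t)) \<noteq> top"
      using U(3) by (metis ennreal_less_top less_irrefl less_trans)
  qed simp
  have "ennreal (\<Sum>i. diameter (U i) powr t) < ennreal (\<epsilon> / 2)"
    using U(3) by (subst (asm) suminf_ennreal2[OF _ sumU]) simp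
  then have le: "(\<Sum>i. diameter (U i) powr t) < \<epsilon> / 2"
    by (subst (asm) ennreal_less_iff) (simp_all add: suminf_nonneg[OF sumU])
  define f where "f i = diameter (U i) powr t + \<epsilon> / 2 * (1 / 2) ^ Suc i" for i
  define d where "d i = f i powr (1 / t)" for i
  have f: "0 < f i" for i unfolding f_def using \<epsilon> by (intro add_nonneg_pos) auto
  have d_t: "d i powr t = f i" for i
    using t f[of i] by (simp add: d_def powr_powr)
  have f_sums: "f sums ((\<Sum>i. diameter (U i) powr t) + \<epsilon> / 2 * 1)"
    unfolding f_def by (intro sums_add sums_mult power_half_series summable_sums sumU)
  show ?thesis
  proof (rule that[OF U(1,2), of d])
    show "diameter (U i) \<le> d i" for i
    proof -
      have "diameter (U i) = (diameter (U i) powr t) powr (1 / t)"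
        using t diameter_ge_0[OF U(2)[of i]] by (simp add: powr_powr)
      also have "\<dots> \<le> d i"
        unfolding d_def f_def using t \<epsilon> by (intro powr_mono2) auto
      finally show ?thesis .
    qed
    show "0 < d i" for i using f[of i] by (simp add: d_def)
    show "summable (\<lambda>i. d i powr t)" using f_sums by (simp add: d_t sums_iff)
    show "(\<Sum>i. d i powr t) \<le> \<epsilon>" using f_sums le by (simp add: d_t sums_iff)
  qed
qed

section \<open>The exponents\<close>

text \<open>Positivity of the lower limit gives the bound for large \<open>n\<close>; irrationality extends it to all
  \<open>n\<close> at the price of a smaller constant.\<close>

lemma badly_approx_of_dioph_type_less:
  assumes irr: "\<alpha> \<notin> \<rat>" and less: "dioph_type \<alpha> < ereal \<theta>"
  obtains c where "0 < c" "\<And>n. 1 \<le> n \<Longrightarrow> c * real n powr (- \<theta>) \<le> dist_int (real n * \<alpha>)"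
proof -
  define f where "f n = real n powr \<theta> * dist_int (real n * \<alpha>)" for n
  have f0: "0 \<le> f n" for n by (simp add: f_def dist_int_nonneg)
  have f_pos: "0 < f n" if "1 \<le> n" for n
    using dist_int_irrational_pos[OF irr that] that by (simp add: f_def)
  have upper: "x \<le> dioph_type \<alpha>"
    if "x \<in> insert 1 {ereal \<theta> | \<theta>. 1 \<le> \<theta> \<and>
       liminf (\<lambda>n. ereal (real n powr \<theta> * dist_int (real n * \<alpha>))) = 0}" for x
    unfolding dioph_type_def by (rule Sup_upper[OF that])
  have "1 \<le> dioph_type \<alpha>" by (rule upper) simp
  then have "1 < ereal \<theta>" using less by (rule le_less_trans)
  then have \<theta>1: "1 \<le> \<theta>" by simp
  have "liminf (\<lambda>n. ereal (f n)) \<noteq> 0"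
  proof
    assume "liminf (\<lambda>n. ereal (f n)) = 0"
    then have "ereal \<theta> \<le> dioph_type \<alpha>"
      using \<theta>1 by (intro upper) (simp add: f_def)
    with less show False by simp
  qed
  moreover have "0 \<le> liminf (\<lambda>n. ereal (f n))"
    using f0 by (intro Liminf_bounded) simp
  ultimately have "0 < liminf (\<lambda>n. ereal (f n))" by simp
  then obtain e where e: "0 < ereal e" "ereal e < liminf (\<lambda>n. ereal (f n))"
    using ereal_dense2 by blast
  obtain n0 where n0: "\<And>n. n0 \<le> n \<Longrightarrow> e < f n"
    using less_LiminfD[OF e(2)] by (auto simp: eventually_sequentially)
  define c where "c = Min (insert e (f ` {1..n0}))"
  show ?thesis
  proof (rule that)
    show "0 < c"
      unfolding c_def using e(1) f_pos by (subst Min_gr_iff) auto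
    fix n :: nat assume n: "1 \<le> n"
    have "c \<le> f n"
    proof (cases "n \<le> n0")
      case True
      then show ?thesis unfolding c_def using n by (intro Min_le) auto
    next
      case False
      have "c \<le> e" unfolding c_def by (intro Min_le) auto
      with n0[of n] False show ?thesis by simp
    qed
    then have "c * real n powr (- \<theta>) \<le> f n * real n powr (- \<theta>)"
      by (intro mult_right_mono) auto
    also have "\<dots> = dist_int (real n * \<alpha>) * (real n powr \<theta> * real n powr (- \<theta>))"
      by (simp only: f_def mult_ac)
    also have "real n powr \<theta> * real n powr (- \<theta>) = 1"
      using n unfolding powr_add[symmetric] by simp
    finally show "c * real n powr (- \<theta>) \<le> dist_int (real n * \<alpha>)" by simp
  qed
qed

lemma u_exp_nonneg:
  assumes "\<And>n. 1 \<le> n \<Longrightarrow> 0 < \<phi> n" "\<phi> \<longlonglongrightarrow> 0"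
  shows "0 \<le> u_exp \<phi>"
proof -
  have "eventually (\<lambda>n. 0 \<le> ereal (ln (real n) / - ln (\<phi> n))) sequentially"
    using order_tendstoD(2)[OF assms(2) zero_less_one] eventually_ge_at_top[of 1]
  proof eventually_elim
    case (elim n)
    have "ln (\<phi> n) < 0" using elim assms(1)[of n] by simp
    moreover have "0 \<le> ln (real n)" using elim by simp
    ultimately show ?case by (simp add: divide_nonneg_neg)
  qed
  then have "0 \<le> liminf (\<lambda>n. ereal (ln (real n) / - ln (\<phi> n)))"
    by (rule Liminf_bounded)
  also have "\<dots> \<le> u_exp \<phi>"
    unfolding u_exp_def by (rule Liminf_le_Limsup) simp
  finally show ?thesis .
qed

text \<open>With \<open>s > 0\<close>, the bound \<open>ln n / - ln (\<phi> n) \<le> s\<close> says that \<open>\<phi> n \<le> n powr (- 1 / s)\<close>.\<close>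

lemma ln_ratio_le_iff:
  assumes "0 < s" "0 < x" "x < 1" "1 \<le> n"
  shows "ln (real n) / - ln x \<le> s \<longleftrightarrow> x \<le> real n powr (- (1 / s))"
proof -
  have "ln x < 0" using assms by simp
  then have "ln (real n) / - ln x \<le> s \<longleftrightarrow> ln (real n) \<le> s * - ln x"
    by (subst pos_divide_le_eq) auto
  also have "\<dots> \<longleftrightarrow> ln x \<le> - (1 / s) * ln (real n)"
    using assms(1) by (simp add: field_simps) linarith
  also have "\<dots> \<longleftrightarrow> ln x \<le> ln (real n powr (- (1 / s)))"
    using assms by (simp add: ln_powr)
  also have "\<dots> \<longleftrightarrow> x \<le> real n powr (- (1 / s))"
    using assms by (subst ln_le_cancel_iff) auto
  finally show ?thesis .
qed

lemma infinitely_often_large_of_less_u_exp: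
  assumes "\<And>n. 1 \<le> n \<Longrightarrow> 0 < \<phi> n" "\<phi> \<longlonglongrightarrow> 0" "0 < s" "ereal s < u_exp \<phi>"
  shows "infinite {N. 1 \<le> N \<and> real N powr (- (1 / s)) < \<phi> N}"
proof
  assume "finite {N. 1 \<le> N \<and> real N powr (- (1 / s)) < \<phi> N}"
  then have "eventually (\<lambda>N. N \<notin> {N. 1 \<le> N \<and> real N powr (- (1 / s)) < \<phi> N}) sequentially"
    by (simp add: eventually_cofinite flip: cofinite_eq_sequentially)
  then have "eventually (\<lambda>N. ereal (ln (real N) / - ln (\<phi> N)) \<le> ereal s) sequentially"
    using order_tendstoD(2)[OF assms(2) zero_less_one] eventually_ge_at_top[of 1]
  proof eventually_elim
    case (elim N)
    then have "\<phi> N \<le> real N powr (- (1 / s))" by auto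
    then show ?case
      using ln_ratio_le_iff[OF assms(3) assms(1)[OF elim(3)] elim(2,3)] by simp
  qed
  then have "u_exp \<phi> \<le> ereal s"
    unfolding u_exp_def by (rule Limsup_bounded)
  with assms(4) show False by simp
qed

lemma summable_powr_of_u_exp_less:
  assumes "\<And>n. 1 \<le> n \<Longrightarrow> 0 < \<phi> n" "\<phi> \<longlonglongrightarrow> 0" "u_exp \<phi> < ereal s"
  shows "summable (\<lambda>n. \<phi> n powr s)"
proof -
  obtain s1 where s1: "u_exp \<phi> < ereal s1" "ereal s1 < ereal s"
    using ereal_dense2[OF assms(3)] by blast
  have "0 < ereal s1"
    using u_exp_nonneg[OF assms(1,2)] s1(1) by (rule le_less_trans)
  then have s1_pos: "0 < s1" "s1 < s" using s1(2) by auto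
  have "eventually (\<lambda>n. ereal (ln (real n) / - ln (\<phi> n)) < ereal s1) sequentially"
    using s1(1) unfolding u_exp_def by (rule Limsup_lessD)
  then have "eventually (\<lambda>n. norm (\<phi> n powr s) \<le> real n powr (- (s / s1))) sequentially"
    using order_tendstoD(2)[OF assms(2) zero_less_one] eventually_ge_at_top[of 1]
  proof eventually_elim
    case (elim n)
    have "ln (real n) / - ln (\<phi> n) \<le> s1" using elim(1) by simp
    then have "\<phi> n \<le> real n powr (- (1 / s1))"
      using ln_ratio_le_iff[OF s1_pos(1) assms(1)[OF elim(3)] elim(2,3)] by simp
    then have "\<phi> n powr s \<le> (real n powr (- (1 / s1))) powr s"
      using s1_pos assms(1)[OF elim(3)] by (intro powr_mono2) auto
    then show ?case by (simp add: powr_powr)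
  qed
  moreover have "summable (\<lambda>n. real n powr (- (s / s1)))"
    unfolding summable_real_powr_iff using s1_pos by simp
  ultimately show ?thesis by (rule summable_comparison_test_ev)
qed

section \<open>Upper and lower bound for the dimension\<close>

lemma hausdorff_measure_mono:
  assumes "A \<subseteq> B"
  shows "hausdorff_measure s A \<le> hausdorff_measure s B"
  unfolding hausdorff_measure_def hausdorff_pre_measure_def
  by (intro SUP_mono' Inf_superset_mono) (use assms in auto)

text \<open>Although \<^const>\<open>E_set\<close> is unbounded, each of its points lies, for a single integer \<open>a\<close>, in
  infinitely many of the intervals of radius \<open>\<phi> n\<close> about \<open>frac (n\<alpha>) + a\<close>.\<close>

lemma hausdorff_measure_E_set_eq_0:
  assumes pos: "\<And>n. 1 \<le> n \<Longrightarrow> 0 < \<phi> n" and lim: "\<phi> \<longlonglongrightarrow> 0"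
    and s: "u_exp \<phi> < ereal s"
  shows "hausdorff_measure s (E_set \<phi> \<alpha>) = 0"
proof -
  have "0 < ereal s"
    using u_exp_nonneg[OF pos lim] s by (rule le_less_trans)
  then have s0: "0 < s" by simp
  \<comment> \<open>The value \<open>\<phi> 0\<close> is unconstrained; if it is not positive, the ball with \<open>n = 0\<close> is empty.\<close>
  define B where "B a n = ball (frac (real n * \<alpha>) + real_of_int a) (\<phi> n)" for a n
  define L where "L a = {y. infinite {n. y \<in> B a n}}" for a
  have L_null: "hausdorff_measure s (L a) = 0" for a
    unfolding L_def
  proof (rule hausdorff_measure_infinitely_often_eq_0[OF s0])
    show "bounded (B a n)" for n by (simp add: B_def)
    have "eventually (\<lambda>n. norm (diameter (B a n) powr s) \<le> 2 powr s * \<phi> n powr s) sequentially"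
      using eventually_ge_at_top[of 1]
    proof eventually_elim
      case (elim n)
      then show ?case using pos[of n] by (simp add: B_def powr_mult)
    qed
    then show "summable (\<lambda>n. diameter (B a n) powr s)"
      by (rule summable_comparison_test_ev)
        (intro summable_mult summable_powr_of_u_exp_less pos lim s)
  qed
  have "E_set \<phi> \<alpha> \<subseteq> (\<Union>k. L (int_decode k))"
  proof
    fix y assume "y \<in> E_set \<phi> \<alpha>"
    then have inf: "infinite {n. 1 \<le> n \<and> dist_int (real n * \<alpha> - y) < \<phi> n}"
      by (simp add: E_set_def)
    \<comment> \<open>Once \<open>\<phi> n < 1\<close>, only finitely many shifts \<open>a\<close> can occur, so one occurs infinitely often.\<close>
    obtain n0 where n0: "\<And>n. n0 \<le> n \<Longrightarrow> \<phi> n < 1"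
      using order_tendstoD(2)[OF lim zero_less_one] by (auto simp: eventually_sequentially)
    have "\<exists>a\<in>{\<lfloor>y\<rfloor> - 2..\<lfloor>y\<rfloor> + 2}. y \<in> L a"
    proof (rule ccontr)
      assume "\<not> ?thesis"
      then have "finite (\<Union>a\<in>{\<lfloor>y\<rfloor> - 2..\<lfloor>y\<rfloor> + 2}. {n. y \<in> B a n})"
        by (intro finite_UN_I) (auto simp: L_def)
      moreover have "{n. 1 \<le> n \<and> dist_int (real n * \<alpha> - y) < \<phi> n}
          \<subseteq> {..n0} \<union> (\<Union>a\<in>{\<lfloor>y\<rfloor> - 2..\<lfloor>y\<rfloor> + 2}. {n. y \<in> B a n})"
      proof
        fix n assume n: "n \<in> {n. 1 \<le> n \<and> dist_int (real n * \<alpha> - y) < \<phi> n}"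
        show "n \<in> {..n0} \<union> (\<Union>a\<in>{\<lfloor>y\<rfloor> - 2..\<lfloor>y\<rfloor> + 2}. {n. y \<in> B a n})"
        proof (cases "n \<le> n0")
          case False
          define a where "a = \<lfloor>real n * \<alpha>\<rfloor> - round (real n * \<alpha> - y)"
          have eq: "frac (real n * \<alpha>) + real_of_int a - y
              = (real n * \<alpha> - y) - of_int (round (real n * \<alpha> - y))"
            by (simp add: a_def frac_def)
          have near: "\<bar>frac (real n * \<alpha>) + real_of_int a - y\<bar> < \<phi> n"
            unfolding eq using n by (simp add: dist_int_def)
          have "\<phi> n < 1" using n0[of n] False by simp
          with near have "\<bar>frac (real n * \<alpha>) + real_of_int a - y\<bar> < 1" by linarith
          then have "real_of_int a < y + 1" "y - 2 < real_of_int a"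
            using frac_ge_0[of "real n * \<alpha>"] frac_lt_1[of "real n * \<alpha>"] by linarith+
          then have "a \<in> {\<lfloor>y\<rfloor> - 2..\<lfloor>y\<rfloor> + 2}" by (simp; linarith)
          moreover have "y \<in> B a n"
            using near by (simp add: B_def dist_real_def)
          ultimately show ?thesis by blast
        qed simp
      qed
      ultimately show False using inf by (meson finite_Un finite_atMost finite_subset)
    qed
    then obtain a where "y \<in> L a" by blast
    then have "y \<in> L (int_decode (int_encode a))" by simp
    then show "y \<in> (\<Union>k. L (int_decode k))" by blast
  qed
  then have "hausdorff_measure s (E_set \<phi> \<alpha>) \<le> hausdorff_measure s (\<Union>k. L (int_decode k))"
    by (rule hausdorff_measure_mono)
  also have "\<dots> = 0" by (rule hausdorff_measure_UN_eq_0) (rule L_null)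
  finally show ?thesis by simp
qed

text \<open>The states of the construction are triples of a centre, a radius and an index; the index of
  the first state plays no role, since the approximation property is only required of later ones.\<close>

lemma hausdorff_measure_E_set_neq_0:
  assumes irr: "\<alpha> \<notin> \<rat>"
    and t: "0 < t" "t < s" "s \<le> 1"
    and c: "0 < c"
    and bad: "\<And>n. 1 \<le> n \<Longrightarrow> c * real n powr (- (1 / s)) \<le> dist_int (real n * \<alpha>)"
    and inf: "infinite {N. 1 \<le> N \<and> real N powr (- (1 / s)) < \<phi> N}"
    and anti: "antimono_on {1..} \<phi>"
  shows "hausdorff_measure t (E_set \<phi> \<alpha>) \<noteq> 0"
proof
  assume "hausdorff_measure t (E_set \<phi> \<alpha>) = 0"
  then obtain U :: "nat \<Rightarrow> real set" and d :: "nat \<Rightarrow> real" where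
    U: "E_set \<phi> \<alpha> \<subseteq> (\<Union>i. U i)" "\<And>i. bounded (U i)" "\<And>i. diameter (U i) \<le> d i"
    and d: "\<And>i. 0 < d i" "summable (\<lambda>i. d i powr t)" "(\<Sum>i. d i powr t) \<le> 1 / 512"
    by (rule null_set_cheap_cover[OF t(1), of "E_set \<phi> \<alpha>" "1 / 512"]) (simp, blast)
  define P where "P k z = (case z of (p, r, n) \<Rightarrow> 0 < r \<and> r \<le> (1 / 2) ^ k \<and>
    cover_cost U d t (cball p r) \<le> r powr t / 512)" for k :: nat and z :: "real \<times> real \<times> nat"
  define Q where "Q z z' = (case z of (p, r, n) \<Rightarrow> case z' of (p', r', n') \<Rightarrow>
    n < n' \<and> cball p' r' \<subseteq> cball p r \<and> p' - real n' * \<alpha> \<in> \<int> \<and> r' < \<phi> n')"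
    for z z' :: "real \<times> real \<times> nat"
  have "\<exists>z. \<forall>k. P k (z k) \<and> Q (z k) (z (Suc k))"
  proof (rule dependent_nat_choice)
    have "cover_cost U d t (cball 0 1) \<le> (\<Sum>i. d i powr t)"
      unfolding cover_cost_def using d(2)
      by (intro suminf_le summable_restrict) auto
    then have "P 0 (0, 1, 0)" using d(3) by (simp add: P_def)
    then show "\<exists>z. P 0 z" by blast
  next
    fix z k assume "P k z"
    moreover obtain p r n where z: "z = (p, r, n)" by (cases z)
    ultimately have r: "0 < r" "r \<le> (1 / 2) ^ k"
      and cost: "cover_cost U d t (cball p r) \<le> r powr t / 512" by (auto simp: P_def)
    have "(1 / 2 :: real) ^ k \<le> 1" by (rule power_le_one) auto
    then have r1: "r \<le> 1" using r(2) by linarith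
    obtain p' r' n' where n': "n < n'" "0 < r'" "r' \<le> r / 2" "cball p' r' \<subseteq> cball p r"
      "p' - real n' * \<alpha> \<in> \<int>" "r' < \<phi> n'" "cover_cost U d t (cball p' r') \<le> r' powr t / 512"
      using nested_ball_step[OF irr t c bad inf anti U(2,3) d(1,2) r(1) r1 cost, of n] by blast
    have "P (Suc k) (p', r', n')" using n' r by (simp add: P_def)
    moreover have "Q z (p', r', n')" using n' by (simp add: Q_def z)
    ultimately show "\<exists>z'. P (Suc k) z' \<and> Q z z'" by blast
  qed
  then obtain z where z: "\<And>k. P k (z k)" "\<And>k. Q (z k) (z (Suc k))" by blast
  define p r n where "p k = fst (z k)" and "r k = fst (snd (z k))" and "n k = snd (snd (z k))" for k
  have r: "0 < r k" "r k \<le> (1 / 2) ^ k" "cover_cost U d t (cball (p k) (r k)) \<le> r k powr t / 512" for k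
    using z(1)[of k] by (auto simp: P_def p_def r_def split: prod.splits)
  have step: "n k < n (Suc k)" "cball (p (Suc k)) (r (Suc k)) \<subseteq> cball (p k) (r k)"
    "p (Suc k) - real (n (Suc k)) * \<alpha> \<in> \<int>" "r (Suc k) < \<phi> (n (Suc k))" for k
    using z(2)[of k] by (auto simp: Q_def p_def r_def n_def split: prod.splits)
  have "\<Inter>(range (\<lambda>k. cball (p k) (r k))) \<noteq> {}"
  proof (rule compact_nest)
    show "cball (p k) (r k) \<noteq> {}" for k using r(1)[of k] by simp
    show "cball (p k) (r k) \<subseteq> cball (p j) (r j)" if "j \<le> k" for j k
      using lift_Suc_antimono_le[of "\<lambda>k. cball (p k) (r k)", OF step(2) that] .
  qed simp
  then obtain y where y: "\<And>k. y \<in> cball (p k) (r k)" by blast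
  have "y \<in> E_set \<phi> \<alpha>"
  proof -
    have "strict_mono (\<lambda>k. n (Suc k))"
      using step(1) by (simp add: strict_mono_Suc_iff)
    then have "infinite (range (\<lambda>k. n (Suc k)))"
      by (intro range_inj_infinite strict_mono_imp_inj_on)
    moreover have "range (\<lambda>k. n (Suc k)) \<subseteq> {n. 1 \<le> n \<and> dist_int (real n * \<alpha> - y) < \<phi> n}"
    proof (rule image_subsetI)
      fix k
      obtain m :: int where m: "p (Suc k) - real (n (Suc k)) * \<alpha> = of_int m"
        using step(3)[of k] by (auto elim: Ints_cases)
      have "dist_int (real (n (Suc k)) * \<alpha> - y) \<le> \<bar>(real (n (Suc k)) * \<alpha> - y) - of_int (- m)\<bar>"
        by (rule dist_int_le_dist_of_int)
      also have "(real (n (Suc k)) * \<alpha> - y) - of_int (- m) = p (Suc k) - y"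
        using m by simp
      also have "\<bar>p (Suc k) - y\<bar> \<le> r (Suc k)"
        using y[of "Suc k"] by (simp add: dist_real_def)
      also have "\<dots> < \<phi> (n (Suc k))" by (rule step(4))
      finally show "n (Suc k) \<in> {n. 1 \<le> n \<and> dist_int (real n * \<alpha> - y) < \<phi> n}"
        using step(1)[of k] by simp
    qed
    ultimately show ?thesis
      unfolding E_set_def using infinite_super by blast
  qed
  then obtain i where i: "y \<in> U i" using U(1) by blast
  have "d i \<le> (1 / 2) ^ k" for k
  proof -
    have "d i powr t \<le> cover_cost U d t (cball (p k) (r k))"
      using i y[of k] by (intro powr_le_cover_cost[OF d(2)]) blast
    also have "\<dots> \<le> r k powr t"
      using r(3)[of k] powr_ge_zero[of "r k" t] by linarith
    finally have "\<not> r k < d i"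
      using powr_less_mono2[of t "r k" "d i"] t(1) r(1)[of k] by auto
    then show ?thesis using r(2)[of k] by linarith
  qed
  moreover obtain k where "(1 / 2) ^ k < d i"
    using real_arch_pow_inv[OF d(1)[of i], of "1 / 2"] by auto
  ultimately show False by (meson not_le)
qed

theorem corollary1p3:
  fixes \<alpha> :: real and \<phi> :: "nat \<Rightarrow> real"
  assumes "\<alpha> \<notin> \<rat>"
    and "\<And>n. 1 \<le> n \<Longrightarrow> 0 < \<phi> n"
    and "antimono_on {1..} \<phi>"
    and "\<phi> \<longlonglongrightarrow> 0"
    and "dioph_type \<alpha> \<le> 1 / u_exp \<phi>"
  shows "hausdorff_dim (E_set \<phi> \<alpha>) = u_exp \<phi>"
proof (rule antisym)
  have u0: "0 \<le> u_exp \<phi>" by (rule u_exp_nonneg[OF assms(2,4)])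
  show "hausdorff_dim (E_set \<phi> \<alpha>) \<le> u_exp \<phi>"
  proof (rule dense_ge)
    fix x assume less: "u_exp \<phi> < x"
    show "hausdorff_dim (E_set \<phi> \<alpha>) \<le> x"
    proof (cases x)
      case (real v)
      have "0 < x" using u0 less by (rule le_less_trans)
      then show ?thesis
        unfolding hausdorff_dim_def
        using hausdorff_measure_E_set_eq_0[OF assms(2,4) less[unfolded real]]
        by (intro Inf_lower CollectI exI[of _ v]) (auto simp: real)
    qed (use u0 less in auto)
  qed
  show "u_exp \<phi> \<le> hausdorff_dim (E_set \<phi> \<alpha>)"
    unfolding hausdorff_dim_def
  proof (rule Inf_greatest, clarify)
    fix t assume t: "0 < t" "hausdorff_measure t (E_set \<phi> \<alpha>) = 0"
    show "u_exp \<phi> \<le> ereal t"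
    proof (rule ccontr)
      assume "\<not> u_exp \<phi> \<le> ereal t"
      then have "ereal t < u_exp \<phi>" by simp
      from ereal_dense2[OF this] obtain s where s: "ereal t < ereal s" "ereal s < u_exp \<phi>"
        by blast
      have s0: "0 < s" using s(1) t(1) by simp
      have "1 / u_exp \<phi> < ereal (1 / s)"
      proof (cases "u_exp \<phi>")
        case (real v)
        then have "s < v" using s(2) by simp
        then have "1 / v < 1 / s" using s0 by (intro divide_strict_left_mono) auto
        then show ?thesis using real s0 \<open>s < v\<close> by (simp add: one_ereal_def)
      qed (use s s0 in auto)
      then have type_less: "dioph_type \<alpha> < ereal (1 / s)"
        using assms(5) by (rule le_less_trans[rotated])
      have "1 \<le> dioph_type \<alpha>" unfolding dioph_type_def by (rule Sup_upper) simp
      then have "1 < ereal (1 / s)" using type_less by (rule le_less_trans)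
      then have s1: "s \<le> 1" using s0 by (simp add: field_simps)
      obtain c where c: "0 < c"
        "\<And>n. 1 \<le> n \<Longrightarrow> c * real n powr (- (1 / s)) \<le> dist_int (real n * \<alpha>)"
        using badly_approx_of_dioph_type_less[OF assms(1) type_less] by blast
      have "t < s" using s(1) by simp
      from hausdorff_measure_E_set_neq_0[OF assms(1) t(1) this s1 c
          infinitely_often_large_of_less_u_exp[OF assms(2,4) s0 s(2)] assms(3)] t(2)
      show False by simp
    qed
  qed
qed

end
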